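(* Let $\Gamma$ be a finite additive Abelian group. Suppose $H$ is a connected (edge-weighted) graph on vertex set $\Gamma$ whose adjacency matrix is a $\Gamma$-circulant matrix $A=(\beta(i-j))_{i,j\in\Gamma}$, where $\beta:\Gamma\to\mathbb{C}$ satisfies $\beta(-i)=\beta(i)$, and that $\widehat{H}$ is the edge-weighted graph on vertex set $\Gamma$ with adjacency matrix $\widehat{A}$. Suppose further that $A$ has eigenvector $\mathbf{1}$ (the all-one vector) with eigenvalue $s$, has minimum polynomial $p_A(t)$ (of degree $\ell$), and that $$\frac{p_A(t)}{t-s}=q(t)=q_0+q_1t+\cdots+q_{\ell-1}t^{\ell-1}.$$ Then a contractor for the graph parameter $\mathrm{hom}(\,\cdot\,,\widehat{H})$ is given by $$Z=\frac{1}{q(s)}\sum_{0\le k\le\ell-1}q_kP_1^{k},$$ where $P_1^{k}$ is the 2-labelled graph consisting of two vertices, one labelled $1$ and the other labelled $2$, joined by $k$ parallel edges (in particular, $P_1^0=\overline{K}_2$ consists of two isolated vertices, one labelled $1$ and the other $2$).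
   Context: **Weighted graphs.** An edge-weighted graph $K$ has a symmetric adjacency matrix $(\beta_K(ij))_{i,j\in V(K)}$ of edge weights (all vertex weights are 1); vertices $i,j$ are joined by an edge when the weight $\beta_K(ij)$ is non-zero. An ordinary graph is the case of weights 0 and 1. **Fourier transform.** Fix a commutative ring structure with unity on the finite Abelian group $\Gamma$ and a generating character $\chi$, i.e. a homomorphism $\chi:\Gamma\to\mathbb{C}^\times$ such that, writing $\chi_x(y)=\chi(xy)$, the map $x\mapsto\chi_x$ is an isomorphism from $\Gamma$ to its character group (such a choice always exists). For $\alpha:\Gamma\to\mathbb{C}$ its Fourier transform is $\widehat{\alpha}(y)=\sum_{x\in\Gamma}\alpha(x)\chi_y(-x)$. **$\Gamma$-circulant matrices.** A matrix $A$ with rows and columns indexed by $\Gamma$ is $\Gamma$-circulant if its $(i,j)$ entry is $\beta(i-j)$ for some function $\beta:\Gamma\to\mathbb{C}$; then $\widehat{A}$ denotes the matrix with $(i,j)$ entry $\widehat{\beta}(i-j)$. **Homomorphism numbers.** For an edge-weighted graph $K$ and a finite graph $G$, $\mathrm{hom}(G,K)=\sum_{\psi:V(G)\to V(K)}\prod_{uv\in E(G)}\beta_K(\psi(u)\psi(v))$, the product taken over edges with multiplicity (a loop at $u$ contributes $\beta_K(\psi(u)\psi(u))$). **2-labelled graphs.** A 2-labelled graph is a finite graph $X$, without loops but possibly with parallel edges, together with a map $\lambda:\{1,2\}\to V(X)$ (the vertex $\lambda(i)$ is said to carry label $i$; a vertex may carry both labels). A 2-labelled quantum graph is a finite formal linear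 combination of 2-labelled graphs with real coefficients (complex coefficients if the weights $\beta$ are not real). The product $XY$ of 2-labelled graphs is obtained by taking the disjoint union of $X$ and $Y$ and identifying vertices carrying the same label (keeping all edges, with multiplicity); it is extended bilinearly to quantum graphs. $K_1$ denotes a single vertex carrying both labels, so $XK_1$ is $X$ with its vertices labelled 1 and 2 identified. **Contractor.** A graph parameter $h$ (an isomorphism-invariant function on graphs) is evaluated on a 2-labelled graph by ignoring labels and is extended linearly to 2-labelled quantum graphs. A 2-labelled quantum graph $Z$ is a contractor for $h$ if $h(XZ)=h(XK_1)$ for every 2-labelled graph $X$ whose vertices labelled 1 and 2 are distinct and non-adjacent (equivalently, for all linear combinations of such $X$).
   Formalization: It is additionally assumed that β is non-negative or that every eigenvector of A for s is a multiple of 1; without this the claim fails, e.g. for Γ = Z_4 and β = (0,1,-1,1). *)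

theory Defs
  imports
    "HOL-Analysis.Analysis"
    "HOL-Computational_Algebra.Polynomial"
    "HOL-Library.FuncSet"
    "HOL-Library.Multiset"
    "HOL-Library.Nat_Bijection"
    "HOL-Library.Poly_Mapping"
    "HOL-Library.Uprod"
begin

text \<open>
  The group is a type of class \<open>{finite, comm_ring}\<close>, carrying the chosen ring structure. The
  class \<open>comm_ring_1\<close> would exclude the trivial group, because it demands \<open>0 \<noteq> 1\<close>; the unity is
  therefore a separate assumption of the theorem.
\<close>

definition group_character :: "('g::ab_group_add \<Rightarrow> complex) \<Rightarrow> bool" where
  "group_character \<psi> \<longleftrightarrow> (\<forall>x. \<psi> x \<noteq> 0) \<and> (\<forall>x y. \<psi> (x + y) = \<psi> x * \<psi> y)"

definition generating_character :: "('g::comm_ring \<Rightarrow> complex) \<Rightarrow> bool" where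
  "generating_character \<psi> \<longleftrightarrow>
     group_character \<psi> \<and>
     (\<forall>x x'. (\<lambda>y. \<psi> ((x + x') * y)) = (\<lambda>y. \<psi> (x * y) * \<psi> (x' * y))) \<and>
     bij_betw (\<lambda>x y. \<psi> (x * y)) UNIV {\<phi>. group_character \<phi>}"

definition fourier ::
    "('g::{finite, comm_ring} \<Rightarrow> complex) \<Rightarrow> ('g \<Rightarrow> complex) \<Rightarrow> 'g \<Rightarrow> complex" where
  "fourier \<psi> \<alpha> y = (\<Sum>x\<in>UNIV. \<alpha> x * \<psi> (y * (- x)))"

definition circulant :: "('g::{finite, ab_group_add} \<Rightarrow> complex) \<Rightarrow> ((complex, 'g) vec, 'g) vec" where
  "circulant \<beta> = (\<chi> i j. \<beta> (i - j))"

definition ones :: "complex ^ 'n" where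
  "ones = (\<chi> i. 1)"


text \<open>
  Powers are taken with respect to \<open>**\<close>; the multiplication \<open>*\<close> that the library puts on
  \<open>complex ^ 'n ^ 'n\<close> is the entrywise one.
\<close>

definition matrix_power :: "complex ^ 'n ^ 'n \<Rightarrow> nat \<Rightarrow> complex ^ 'n ^ 'n" where
  "matrix_power A k = (((**) A) ^^ k) (mat 1)"

definition poly_matrix :: "complex poly \<Rightarrow> complex ^ 'n ^ 'n \<Rightarrow> complex ^ 'n ^ 'n" where
  "poly_matrix r A = (\<chi> i j. \<Sum>k\<le>degree r. coeff r k * matrix_power A k $ i $ j)"

definition min_poly :: "complex ^ 'n ^ 'n \<Rightarrow> complex poly" where
  "min_poly A =
     (THE p. lead_coeff p = 1 \<and> poly_matrix p A = 0 \<and>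
             (\<forall>r. r \<noteq> 0 \<and> poly_matrix r A = 0 \<longrightarrow> degree p \<le> degree r))"


text \<open>
  An edge-weighted graph whose vertex set is the type \<open>'w\<close> is a weight function on unordered
  pairs, so that its adjacency matrix is symmetric by construction.
\<close>

type_synonym 'w weighted_graph = "'w uprod \<Rightarrow> complex"

definition adjacency_matrix :: "'w weighted_graph \<Rightarrow> complex ^ 'w ^ 'w" where
  "adjacency_matrix K = (\<chi> i j. K (Upair i j))"

definition weighted_connected :: "'w weighted_graph \<Rightarrow> bool" where
  "weighted_connected K \<longleftrightarrow> (\<forall>i j. (i, j) \<in> {(u, v). K (Upair u v) \<noteq> 0}\<^sup>*)"


text \<open>
  Finite multigraphs, up to isomorphism, are those with vertices in \<open>nat\<close>. An edge is an
  unordered pair, and \<open>Upair u u\<close> is a loop at \<open>u\<close>.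
\<close>

datatype multigraph = Multigraph (verts: "nat set") (edges: "nat uprod multiset")

definition wf_multigraph :: "multigraph \<Rightarrow> bool" where
  "wf_multigraph G \<longleftrightarrow> finite (verts G) \<and> (\<forall>e \<in># edges G. set_uprod e \<subseteq> verts G)"

definition multigraph_iso :: "multigraph \<Rightarrow> multigraph \<Rightarrow> bool" where
  "multigraph_iso G G' \<longleftrightarrow>
     (\<exists>f. bij_betw f (verts G) (verts G') \<and> edges G' = image_mset (map_uprod f) (edges G))"

definition graph_parameter :: "(multigraph \<Rightarrow> complex) \<Rightarrow> bool" where
  "graph_parameter h \<longleftrightarrow>
     (\<forall>G G'. wf_multigraph G \<and> wf_multigraph G' \<and> multigraph_iso G G' \<longrightarrow> h G = h G')"

definition hom_number :: "multigraph \<Rightarrow> 'w::finite weighted_graph \<Rightarrow> complex" where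
  "hom_number G K = (\<Sum>f \<in> verts G \<rightarrow>\<^sub>E UNIV. \<Prod>e \<in># edges G. K (map_uprod f e))"

datatype lgraph = LGraph (unlabel: multigraph) (lab1: nat) (lab2: nat)

definition wf_lgraph :: "lgraph \<Rightarrow> bool" where
  "wf_lgraph X \<longleftrightarrow>
     wf_multigraph (unlabel X) \<and> (\<forall>e \<in># edges (unlabel X). proper_uprod e) \<and>
     lab1 X \<in> verts (unlabel X) \<and> lab2 X \<in> verts (unlabel X)"


text \<open>
  The disjoint union of \<open>X\<close> and \<open>Y\<close> is taken inside \<open>nat\<close> along the bijection \<open>sum_encode\<close>. In
  the product, each class of identified vertices is represented by its least element. When a
  vertex of \<open>X\<close> or \<open>Y\<close> carries both labels, the classes really need the generated equivalence.
\<close>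

abbreviation inl :: "nat \<Rightarrow> nat" where "inl v \<equiv> sum_encode (Inl v)"
abbreviation inr :: "nat \<Rightarrow> nat" where "inr v \<equiv> sum_encode (Inr v)"

definition same_label :: "lgraph \<Rightarrow> lgraph \<Rightarrow> (nat \<times> nat) set" where
  "same_label X Y = {(inl (lab1 X), inr (lab1 Y)), (inl (lab2 X), inr (lab2 Y))}"

definition glue :: "lgraph \<Rightarrow> lgraph \<Rightarrow> nat \<Rightarrow> nat" where
  "glue X Y v = (LEAST u. (u, v) \<in> (same_label X Y \<union> (same_label X Y)\<inverse>)\<^sup>*)"

definition lprod :: "lgraph \<Rightarrow> lgraph \<Rightarrow> lgraph" where
  "lprod X Y =
     LGraph
       (Multigraph
         ((glue X Y \<circ> inl) ` verts (unlabel X) \<union> (glue X Y \<circ> inr) ` verts (unlabel Y))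
         (image_mset (map_uprod (glue X Y \<circ> inl)) (edges (unlabel X)) +
          image_mset (map_uprod (glue X Y \<circ> inr)) (edges (unlabel Y))))
       (glue X Y (inl (lab1 X)))
       (glue X Y (inl (lab2 X)))"

definition K1 :: lgraph where
  "K1 = LGraph (Multigraph {0} {#}) 0 0"

definition P1_pow :: "nat \<Rightarrow> lgraph" where
  "P1_pow k = LGraph (Multigraph {0, 1} (replicate_mset k (Upair 0 1))) 0 1"


type_synonym qgraph = "lgraph \<Rightarrow>\<^sub>0 complex"

definition qgraph_prod :: "qgraph \<Rightarrow> qgraph \<Rightarrow> qgraph" where
  "qgraph_prod Q R =
     (\<Sum>X \<in> Poly_Mapping.keys Q. \<Sum>Y \<in> Poly_Mapping.keys R.
        Poly_Mapping.single (lprod X Y) (Poly_Mapping.lookup Q X * Poly_Mapping.lookup R Y))"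

definition qgraph_eval :: "(multigraph \<Rightarrow> complex) \<Rightarrow> qgraph \<Rightarrow> complex" where
  "qgraph_eval h Q = (\<Sum>X \<in> Poly_Mapping.keys Q. Poly_Mapping.lookup Q X * h (unlabel X))"

definition is_contractor :: "(multigraph \<Rightarrow> complex) \<Rightarrow> qgraph \<Rightarrow> bool" where
  "is_contractor h Z \<longleftrightarrow>
     graph_parameter h \<and>
     (\<forall>Y \<in> Poly_Mapping.keys Z. wf_lgraph Y) \<and>
     (\<forall>X. wf_lgraph X \<and> lab1 X \<noteq> lab2 X \<and> Upair (lab1 X) (lab2 X) \<notin># edges (unlabel X) \<longrightarrow>
        qgraph_eval h (qgraph_prod (Poly_Mapping.single X 1) Z) = h (unlabel (lprod X K1)))"

end

theory Submission
  imports Defs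
begin

text \<open>
  The characters \<open>x \<mapsto> \<psi> (y * x)\<close> are common eigenvectors of all circulant matrices, and the one
  indexed by \<open>y\<close> belongs to the eigenvalue \<open>fourier \<psi> \<beta> y\<close>. By Fourier inversion there are no
  other eigenvalues and the matrix is diagonalizable, so its minimum polynomial is the product of
  the linear factors of the distinct values of the Fourier transform (\<open>min_poly_circulant\<close>). The
  eigenvalue \<open>s\<close> is the value at \<open>0\<close>, and it is taken only there: if it is a simple eigenvalue
  because distinct characters are not proportional, and if \<open>\<beta>\<close> is nonnegative because a value \<open>s\<close>
  at \<open>y\<close> forces equality in the triangle inequality, which makes the character of \<open>y\<close> trivial on
  the support of \<open>\<beta>\<close> and, by connectedness, everywhere. Removing the factor of \<open>s\<close> therefore
  leaves a squarefree \<open>q\<close> that vanishes at \<open>fourier \<psi> \<beta> y\<close> for \<open>y \<noteq> 0\<close> and not at \<open>s\<close>.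

  The weights of \<open>Hhat\<close> are these same eigenvalues: \<open>Hhat (Upair u v) = fourier \<psi> \<beta> (u - v)\<close>.
  Consequently evaluating \<open>q / poly q s\<close> at the weight between \<open>u\<close> and \<open>v\<close> gives the indicator of
  \<open>u = v\<close>. Homomorphisms from a glued graph are pairs of homomorphisms that agree on the labels
  (\<open>hom_number_lprod\<close>), so gluing \<open>k\<close> parallel edges onto \<open>X\<close> multiplies the contribution of each
  map by the \<open>k\<close>-th power of the weight between the images of the labels, while gluing \<open>K1\<close> keeps
  exactly the maps in which these images coincide. Summing over \<open>k\<close> with the coefficients of
  \<open>q / poly q s\<close> thus has the same effect as gluing \<open>K1\<close>.
\<close>

section \<open>Characters and Fourier inversion\<close>

lemma group_character_zero:
  assumes "group_character \<phi>"
  shows "\<phi> 0 = 1"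
proof -
  have "\<phi> (0 + 0) = \<phi> 0 * \<phi> 0" "\<phi> 0 \<noteq> 0"
    using assms unfolding group_character_def by blast+
  then show ?thesis by simp
qed

lemma group_character_minus:
  assumes "group_character \<phi>"
  shows "\<phi> (- x) = inverse (\<phi> x)"
proof -
  have "\<phi> (- x + x) = \<phi> (- x) * \<phi> x"
    using assms unfolding group_character_def by blast
  then have "\<phi> (- x) * \<phi> x = 1"
    using group_character_zero[OF assms] by simp
  then show ?thesis
    using inverse_unique[of "\<phi> x" "\<phi> (- x)"] by (simp add: mult.commute)
qed

text \<open>
  If the norm is largest at \<open>z\<close>, comparing \<open>\<phi> (z + y)\<close> with \<open>\<phi> z\<close> bounds the norm of every
  \<open>\<phi> y\<close> by 1; applied to \<open>x\<close> and \<open>- x\<close> this gives equality.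
\<close>

lemma norm_group_character:
  fixes \<phi> :: "'g::{finite, ab_group_add} \<Rightarrow> complex"
  assumes "group_character \<phi>"
  shows "norm (\<phi> x) = 1"
proof -
  define M where "M = Max (range (\<lambda>x. norm (\<phi> x)))"
  have "M \<in> range (\<lambda>x. norm (\<phi> x))"
    unfolding M_def by (rule Max_in) auto
  then obtain z where z: "norm (\<phi> z) = M" by auto
  have pos: "0 < M"
    using assms unfolding z[symmetric] group_character_def by simp
  have le: "norm (\<phi> y) \<le> 1" for y
  proof -
    have "norm (\<phi> (z + y)) \<le> M"
      unfolding M_def by (rule Max_ge) auto
    moreover have "norm (\<phi> (z + y)) = M * norm (\<phi> y)"
      using assms z unfolding group_character_def by (simp add: norm_mult)
    ultimately show ?thesis
      using pos by simp
  qed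
  have "norm (\<phi> x) \<noteq> 0"
    using assms unfolding group_character_def by simp
  moreover have "inverse (norm (\<phi> x)) \<le> 1"
    using le[of "- x"] by (simp add: group_character_minus[OF assms] norm_inverse)
  ultimately have "1 \<le> norm (\<phi> x)"
    by (simp add: inverse_le_1_iff)
  with le[of x] show ?thesis by simp
qed

lemma cnj_group_character:
  fixes \<phi> :: "'g::{finite, ab_group_add} \<Rightarrow> complex"
  assumes "group_character \<phi>"
  shows "cnj (\<phi> x) = \<phi> (- x)"
proof -
  have "\<phi> x * cnj (\<phi> x) = 1"
    using norm_group_character[OF assms, of x] by (simp add: complex_norm_square[symmetric])
  then show ?thesis
    using inverse_unique[of "\<phi> x" "cnj (\<phi> x)"] group_character_minus[OF assms] by simp
qed

text \<open>
  Translating the summation variable by \<open>a\<close> multiplies the sum by \<open>\<phi> a\<close>.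
\<close>

lemma sum_nontrivial_character:
  fixes \<phi> :: "'g::{finite, ab_group_add} \<Rightarrow> complex"
  assumes "group_character \<phi>" and "\<phi> a \<noteq> 1"
  shows "(\<Sum>x\<in>UNIV. \<phi> x) = 0"
proof -
  have "(\<Sum>x\<in>UNIV. \<phi> x) = (\<Sum>x\<in>UNIV. \<phi> (a + x))"
    by (rule sum.reindex_bij_witness[of _ "\<lambda>x. a + x" "\<lambda>x. x - a"]) auto
  also have "\<dots> = \<phi> a * (\<Sum>x\<in>UNIV. \<phi> x)"
    using assms(1) unfolding group_character_def by (simp add: sum_distrib_left)
  finally show ?thesis using assms(2) by simp
qed

lemma generating_character_group_character:
  "generating_character \<psi> \<Longrightarrow> group_character \<psi>"
  unfolding generating_character_def by blast

lemma generating_character_mult: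
  fixes \<psi> :: "'g::{finite, comm_ring} \<Rightarrow> complex"
  assumes "generating_character \<psi>"
  shows "group_character (\<lambda>x. \<psi> (y * x))"
  using assms unfolding generating_character_def bij_betw_def by auto

lemma generating_character_trivial:
  fixes \<psi> :: "'g::{finite, comm_ring} \<Rightarrow> complex"
  assumes gen: "generating_character \<psi>" and "\<And>x. \<psi> (y * x) = 1"
  shows "y = 0"
proof -
  have "inj (\<lambda>x y. \<psi> (x * y))"
    using gen unfolding generating_character_def bij_betw_def by blast
  moreover have "(\<lambda>x. \<psi> (y * x)) = (\<lambda>x. \<psi> (0 * x))"
    using assms(2) group_character_zero[OF generating_character_group_character[OF gen]] by simp
  ultimately show ?thesis
    unfolding inj_def by blast
qed

lemma generating_character_orthogonality:
  fixes \<psi> :: "'g::{finite, comm_ring} \<Rightarrow> complex"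
  assumes gen: "generating_character \<psi>"
  shows "(\<Sum>x\<in>UNIV. \<psi> (y * x)) = (if y = 0 then of_nat CARD('g) else 0)"
proof (cases "y = 0")
  case True
  then show ?thesis
    using group_character_zero[OF generating_character_group_character[OF gen]] by simp
next
  case False
  then obtain a where "\<psi> (y * a) \<noteq> 1"
    using generating_character_trivial[OF gen] by blast
  then show ?thesis
    using sum_nontrivial_character[OF generating_character_mult[OF gen]] False by simp
qed

section \<open>The spectrum of a circulant matrix\<close>

lemma fourier_zero:
  fixes \<psi> :: "'g::{finite, comm_ring} \<Rightarrow> complex"
  assumes "generating_character \<psi>"
  shows "fourier \<psi> \<beta> 0 = (\<Sum>x\<in>UNIV. \<beta> x)"
  unfolding fourier_def
  using group_character_zero[OF generating_character_group_character[OF assms]] by simp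

lemma circulant_eigenvector:
  fixes \<psi> :: "'g::{finite, comm_ring} \<Rightarrow> complex"
  assumes gen: "generating_character \<psi>"
  shows "(\<Sum>j\<in>UNIV. \<beta> (i - j) * \<psi> (y * j)) = fourier \<psi> \<beta> y * \<psi> (y * i)"
proof -
  have "(\<Sum>j\<in>UNIV. \<beta> (i - j) * \<psi> (y * j)) = (\<Sum>x\<in>UNIV. \<beta> x * \<psi> (y * (i - x)))"
    by (rule sum.reindex_bij_witness[of _ "\<lambda>x. i - x" "\<lambda>x. i - x"]) auto
  also have "\<dots> = (\<Sum>x\<in>UNIV. \<beta> x * \<psi> (y * (- x)) * \<psi> (y * i))"
  proof (rule sum.cong[OF refl])
    fix x
    have "\<psi> (y * (- x + i)) = \<psi> (y * (- x)) * \<psi> (y * i)"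
      using generating_character_mult[OF gen, of y] unfolding group_character_def by blast
    then show "\<beta> x * \<psi> (y * (i - x)) = \<beta> x * \<psi> (y * (- x)) * \<psi> (y * i)"
      by simp
  qed
  finally show ?thesis
    unfolding fourier_def sum_distrib_right .
qed

text \<open>
  The spectral decomposition of the powers. At \<open>k = 0\<close> it is the orthogonality of characters, and
  each multiplication by the matrix produces another factor \<open>fourier \<psi> \<beta> y\<close>, since the characters
  are eigenvectors. The factor \<open>CARD('g)\<close> avoids division.
\<close>

lemma matrix_power_circulant:
  fixes \<psi> :: "'g::{finite, comm_ring} \<Rightarrow> complex"
  assumes gen: "generating_character \<psi>"
  shows "of_nat CARD('g) * matrix_power (circulant \<beta>) k $ i $ j =
    (\<Sum>y\<in>UNIV. fourier \<psi> \<beta> y ^ k * \<psi> (y * (i - j)))"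
proof (induction k arbitrary: i j)
  case 0
  have "(\<Sum>y\<in>UNIV. \<psi> (y * (i - j))) = (\<Sum>y\<in>UNIV. \<psi> ((i - j) * y))"
    by (simp add: mult.commute)
  then show ?case
    unfolding matrix_power_def generating_character_orthogonality[OF gen] by (simp add: mat_def)
next
  case (Suc k)
  let ?P = "matrix_power (circulant \<beta>)"
  have "of_nat CARD('g) * ?P (Suc k) $ i $ j =
      (\<Sum>l\<in>UNIV. \<beta> (i - l) * (of_nat CARD('g) * ?P k $ l $ j))"
    by (simp add: matrix_power_def matrix_matrix_mult_def circulant_def sum_distrib_left algebra_simps)
  also have "\<dots> = (\<Sum>l\<in>UNIV. \<Sum>y\<in>UNIV. \<beta> (i - l) * (fourier \<psi> \<beta> y ^ k * \<psi> (y * (l - j))))"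
    by (simp add: Suc.IH sum_distrib_left)
  also have "\<dots> = (\<Sum>y\<in>UNIV. \<Sum>l\<in>UNIV. \<beta> (i - l) * (fourier \<psi> \<beta> y ^ k * \<psi> (y * (l - j))))"
    by (rule sum.swap)
  also have "\<dots> = (\<Sum>y\<in>UNIV. fourier \<psi> \<beta> y ^ Suc k * \<psi> (y * (i - j)))"
  proof (rule sum.cong[OF refl])
    fix y
    have "(\<Sum>l\<in>UNIV. \<beta> (i - l) * \<psi> (y * (l - j))) = fourier \<psi> \<beta> y * \<psi> (y * (i - j))"
    proof -
      have "(\<Sum>l\<in>UNIV. \<beta> (i - l) * \<psi> (y * (l - j))) =
          (\<Sum>l\<in>UNIV. \<beta> (i - j - l) * \<psi> (y * l))"
        by (rule sum.reindex_bij_witness[of _ "\<lambda>l. l + j" "\<lambda>l. l - j"]) (auto simp: algebra_simps)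
      then show ?thesis
        using circulant_eigenvector[OF gen] by simp
    qed
    moreover have "(\<Sum>l\<in>UNIV. \<beta> (i - l) * (fourier \<psi> \<beta> y ^ k * \<psi> (y * (l - j)))) =
        fourier \<psi> \<beta> y ^ k * (\<Sum>l\<in>UNIV. \<beta> (i - l) * \<psi> (y * (l - j)))"
      by (simp add: sum_distrib_left mult.left_commute)
    ultimately show "(\<Sum>l\<in>UNIV. \<beta> (i - l) * (fourier \<psi> \<beta> y ^ k * \<psi> (y * (l - j)))) =
        fourier \<psi> \<beta> y ^ Suc k * \<psi> (y * (i - j))"
      by (simp add: mult_ac)
  qed
  finally show ?case .
qed

lemma poly_matrix_circulant:
  fixes \<psi> :: "'g::{finite, comm_ring} \<Rightarrow> complex"
  assumes gen: "generating_character \<psi>"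
  shows "of_nat CARD('g) * poly_matrix r (circulant \<beta>) $ i $ j =
    (\<Sum>y\<in>UNIV. poly r (fourier \<psi> \<beta> y) * \<psi> (y * (i - j)))"
proof -
  have "of_nat CARD('g) * poly_matrix r (circulant \<beta>) $ i $ j =
      (\<Sum>k\<le>degree r. coeff r k * (of_nat CARD('g) * matrix_power (circulant \<beta>) k $ i $ j))"
    by (simp add: poly_matrix_def sum_distrib_left mult.left_commute)
  also have "\<dots> = (\<Sum>k\<le>degree r. \<Sum>y\<in>UNIV. coeff r k * fourier \<psi> \<beta> y ^ k * \<psi> (y * (i - j)))"
    by (simp add: matrix_power_circulant[OF gen] sum_distrib_left mult.assoc)
  also have "\<dots> = (\<Sum>y\<in>UNIV. \<Sum>k\<le>degree r. coeff r k * fourier \<psi> \<beta> y ^ k * \<psi> (y * (i - j)))"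
    by (rule sum.swap)
  finally show ?thesis
    by (simp add: poly_altdef sum_distrib_right)
qed

text \<open>
  By the decomposition above, the entries of the matrix polynomial are the Fourier coefficients of
  \<open>y \<mapsto> poly r (fourier \<psi> \<beta> y)\<close>, and Fourier inversion recovers this function from its first column.
\<close>

lemma poly_matrix_circulant_eq_0_iff:
  fixes \<psi> :: "'g::{finite, comm_ring} \<Rightarrow> complex"
  assumes gen: "generating_character \<psi>"
  shows "poly_matrix r (circulant \<beta>) = 0 \<longleftrightarrow> (\<forall>y. poly r (fourier \<psi> \<beta> y) = 0)"
proof
  assume "\<forall>y. poly r (fourier \<psi> \<beta> y) = 0"
  then have "of_nat CARD('g) * poly_matrix r (circulant \<beta>) $ i $ j = (0 :: complex)" for i j
    by (simp add: poly_matrix_circulant[OF gen])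
  then show "poly_matrix r (circulant \<beta>) = 0"
    by (simp add: vec_eq_iff)
next
  assume eq: "poly_matrix r (circulant \<beta>) = 0"
  show "\<forall>y. poly r (fourier \<psi> \<beta> y) = 0"
  proof
    fix z
    \<comment> \<open>Pair the column of index \<open>0\<close> with the inverse of the \<open>z\<close>-th character: orthogonality keeps only
      the term \<open>y = z\<close>.\<close>
    have "0 = (\<Sum>i\<in>UNIV. \<psi> (- z * i) * (of_nat CARD('g) * poly_matrix r (circulant \<beta>) $ i $ 0))"
      by (simp add: eq)
    also have "\<dots> = (\<Sum>i\<in>UNIV. \<Sum>y\<in>UNIV. poly r (fourier \<psi> \<beta> y) * \<psi> ((y - z) * i))"
    proof (intro sum.cong refl)
      fix i
      have "\<psi> (- z * i) * \<psi> (y * i) = \<psi> ((y - z) * i)" for y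
      proof -
        have "\<psi> (- z * i + y * i) = \<psi> (- z * i) * \<psi> (y * i)"
          using generating_character_group_character[OF gen] unfolding group_character_def by blast
        then show ?thesis by (simp add: algebra_simps)
      qed
      then have "poly r (fourier \<psi> \<beta> y) * \<psi> ((y - z) * i) =
          \<psi> (- z * i) * (poly r (fourier \<psi> \<beta> y) * \<psi> (y * (i - 0)))" for y
        by (metis diff_zero mult.left_commute)
      then show "\<psi> (- z * i) * (of_nat CARD('g) * poly_matrix r (circulant \<beta>) $ i $ 0) =
          (\<Sum>y\<in>UNIV. poly r (fourier \<psi> \<beta> y) * \<psi> ((y - z) * i))"
        unfolding poly_matrix_circulant[OF gen] by (simp only: sum_distrib_left)
    qed
    also have "\<dots> = (\<Sum>y\<in>UNIV. \<Sum>i\<in>UNIV. poly r (fourier \<psi> \<beta> y) * \<psi> ((y - z) * i))"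
      by (rule sum.swap)
    also have "\<dots> = (\<Sum>y\<in>UNIV. poly r (fourier \<psi> \<beta> y) * (if y = z then of_nat CARD('g) else 0))"
      by (simp add: sum_distrib_left[symmetric] generating_character_orthogonality[OF gen])
    also have "\<dots> = poly r (fourier \<psi> \<beta> z) * of_nat CARD('g)"
      by (simp add: if_distrib cong: if_cong)
    finally show "poly r (fourier \<psi> \<beta> z) = 0" by simp
  qed
qed

lemma prod_linear_dvd_iff:
  fixes r :: "'a::idom poly"
  assumes "finite S"
  shows "(\<Prod>a\<in>S. [:- a, 1:]) dvd r \<longleftrightarrow> (\<forall>a\<in>S. poly r a = 0)"
  using assms
proof (induction S arbitrary: r)
  case empty
  then show ?case by simp
next
  case (insert b S)
  show ?case
  proof
    assume "(\<Prod>a\<in>insert b S. [:- a, 1:]) dvd r"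
    then obtain t where "r = (\<Prod>a\<in>insert b S. [:- a, 1:]) * t" ..
    then show "\<forall>a\<in>insert b S. poly r a = 0"
      using insert.hyps by (auto simp: poly_prod)
  next
    assume zero: "\<forall>a\<in>insert b S. poly r a = 0"
    then obtain t where t: "r = [:- b, 1:] * t"
      using poly_eq_0_iff_dvd[of r b] by (auto elim: dvdE)
    have "\<forall>a\<in>S. poly t a = 0"
      using zero insert.hyps unfolding t by auto
    then show "(\<Prod>a\<in>insert b S. [:- a, 1:]) dvd r"
      using insert unfolding t by (simp add: mult_dvd_mono del: mult_pCons_left)
  qed
qed

text \<open>
  A polynomial annihilates the matrix exactly if the product of linear factors divides it, so this
  product is the unique monic annihilating polynomial of least degree.
\<close>

lemma min_poly_circulant:
  fixes \<psi> :: "'g::{finite, comm_ring} \<Rightarrow> complex"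
  assumes gen: "generating_character \<psi>"
  shows "min_poly (circulant \<beta>) = (\<Prod>a\<in>range (fourier \<psi> \<beta>). [:- a, 1:])"
proof -
  define m where "m = (\<Prod>a\<in>range (fourier \<psi> \<beta>). [:- a, 1:])"
  have monic: "lead_coeff m = 1"
    unfolding m_def by (simp add: lead_coeff_prod)
  then have "m \<noteq> 0" by auto
  have annih: "poly_matrix r (circulant \<beta>) = 0 \<longleftrightarrow> m dvd r" for r
    unfolding m_def by (simp add: prod_linear_dvd_iff poly_matrix_circulant_eq_0_iff[OF gen])
  have unique: "r = m" if "lead_coeff r = 1" "m dvd r" "degree r \<le> degree m" for r
  proof -
    obtain t where t: "r = m * t" using \<open>m dvd r\<close> ..
    have "r \<noteq> 0" using that(1) by auto
    then have "t \<noteq> 0" using t by auto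
    then have "degree t = 0"
      using that(3) \<open>m \<noteq> 0\<close> by (simp add: t degree_mult_eq)
    moreover have "lead_coeff t = 1"
      using that(1) monic by (simp add: t lead_coeff_mult)
    ultimately have "t = 1"
      by (auto elim!: degree_eq_zeroE)
    then show ?thesis by (simp add: t)
  qed
  show ?thesis
    unfolding min_poly_def annih m_def[symmetric]
    using monic \<open>m \<noteq> 0\<close> dvd_imp_degree_le unique
    by (intro the_equality) auto
qed

text \<open>
  The Perron--Frobenius argument for circulant matrices. Comparing real parts in
  \<open>fourier \<psi> \<beta> y = fourier \<psi> \<beta> 0\<close>, whose right side is the sum of the weights, gives a vanishing
  sum of nonnegative terms, so the \<open>y\<close>-th character is \<open>1\<close> wherever \<open>\<beta>\<close> is non-zero. It is then
  constant along edges, and connectedness makes it trivial.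
\<close>

lemma fourier_eq_fourier_zero_nonneg:
  fixes \<psi> :: "'g::{finite, comm_ring} \<Rightarrow> complex"
  assumes gen: "generating_character \<psi>"
    and nonneg: "\<And>x. \<beta> x \<in> \<real>\<^sub>\<ge>\<^sub>0"
    and H: "adjacency_matrix H = circulant \<beta>"
    and connected: "weighted_connected H"
    and eq: "fourier \<psi> \<beta> y = fourier \<psi> \<beta> 0"
  shows "y = 0"
proof (rule generating_character_trivial[OF gen])
  let ?\<phi> = "\<lambda>x. \<psi> (y * x)"
  have char: "group_character ?\<phi>" by (rule generating_character_mult[OF gen])
  obtain b where b: "\<And>x. \<beta> x = of_real (b x)" "\<And>x. 0 \<le> b x"
    using nonneg unfolding nonneg_Reals_def by (auto simp: image_iff) metis
  have Re_le: "Re (?\<phi> x) \<le> 1" for x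
    using complex_Re_le_cmod[of "?\<phi> x"] norm_group_character[OF char, of x] by simp
  have "(\<Sum>x\<in>UNIV. \<beta> x * ?\<phi> (- x)) = (\<Sum>x\<in>UNIV. \<beta> x)"
    using eq by (simp only: fourier_zero[OF gen]) (simp add: fourier_def)
  then have "Re (\<Sum>x\<in>UNIV. \<beta> x * ?\<phi> (- x)) = Re (\<Sum>x\<in>UNIV. \<beta> x)"
    by simp
  then have "(\<Sum>x\<in>UNIV. b x * (1 - Re (?\<phi> (- x)))) = 0"
    by (simp add: b algebra_simps sum_subtractf)
  then have zero: "b x * (1 - Re (?\<phi> (- x))) = 0" for x
    using sum_nonneg_eq_0_iff[of UNIV "\<lambda>x. b x * (1 - Re (?\<phi> (- x)))"] b(2) Re_le
    by (auto simp del: mult_minus_right)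
  have support: "?\<phi> x = 1" if "\<beta> x \<noteq> 0" for x
  proof -
    have Re: "Re (?\<phi> (- x)) = 1"
      using zero[of x] that b(1) by auto
    then have "Im (?\<phi> (- x)) = 0"
      using norm_group_character[OF char, of "- x"] cmod_power2[of "?\<phi> (- x)"] by simp
    then have "?\<phi> (- x) = 1"
      using Re by (simp add: complex_eq_iff)
    then show ?thesis
      using group_character_minus[OF char, of x] by (metis inverse_eq_1_iff)
  qed
  fix x
  have "(0, x) \<in> {(u, v). H (Upair u v) \<noteq> 0}\<^sup>*"
    using connected unfolding weighted_connected_def by blast
  then show "?\<phi> x = 1"
  proof (induction rule: rtrancl_induct)
    case base
    then show ?case using group_character_zero[OF char] .
  next
    case (step u v)
    have "H (Upair u v) = \<beta> (u - v)"
      using arg_cong[OF H, of "\<lambda>M. M $ u $ v"] by (simp add: adjacency_matrix_def circulant_def)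
    then have "?\<phi> (u - v) = 1"
      using step.hyps support by simp
    moreover have "?\<phi> (u - v + v) = ?\<phi> (u - v) * ?\<phi> v"
      using char unfolding group_character_def by blast
    ultimately show ?case using step.IH by simp
  qed
qed

text \<open>
  If the eigenspace of \<open>fourier \<psi> \<beta> 0\<close> consists of constant vectors, a character in it is constant,
  hence trivial.
\<close>

lemma fourier_eq_fourier_zero_simple:
  fixes \<psi> :: "'g::{finite, comm_ring} \<Rightarrow> complex"
  assumes gen: "generating_character \<psi>"
    and simple: "\<And>v. circulant \<beta> *v v = fourier \<psi> \<beta> 0 *s v \<Longrightarrow> \<exists>c. v = c *s ones"
    and eq: "fourier \<psi> \<beta> y = fourier \<psi> \<beta> 0"
  shows "y = 0"
proof (rule generating_character_trivial[OF gen])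
  let ?v = "(\<chi> j. \<psi> (y * j)) :: (complex, 'g) vec"
  have "circulant \<beta> *v ?v = fourier \<psi> \<beta> 0 *s ?v"
    by (simp add: vec_eq_iff matrix_vector_mult_def circulant_def vector_scalar_mult_def
        circulant_eigenvector[OF gen] eq)
  then obtain c where "?v = c *s ones" using simple by blast
  then have c: "\<psi> (y * j) = c" for j
    by (simp add: vec_eq_iff ones_def vector_scalar_mult_def)
  have "c = 1"
    using c[of 0] group_character_zero[OF generating_character_group_character[OF gen]] by simp
  then show "\<psi> (y * x) = 1" for x using c by simp
qed

text \<open>
  Conjugation turns each character into its inverse, which the evenness of \<open>\<beta>\<close> undoes.
\<close>

lemma fourier_real:
  fixes \<psi> :: "'g::{finite, comm_ring} \<Rightarrow> complex"
  assumes gen: "generating_character \<psi>"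
    and even: "\<And>x. \<beta> (- x) = \<beta> x"
    and real: "\<And>x. \<beta> x \<in> \<real>"
  shows "fourier \<psi> \<beta> y \<in> \<real>"
proof -
  have "cnj (fourier \<psi> \<beta> y) = (\<Sum>x\<in>UNIV. \<beta> x * \<psi> (y * x))"
    using real cnj_group_character[OF generating_character_mult[OF gen], of y "- x" for x]
    by (simp add: fourier_def Reals_cnj_iff)
  also have "\<dots> = fourier \<psi> \<beta> y"
    unfolding fourier_def
    by (rule sum.reindex_bij_witness[of _ uminus uminus]) (auto simp: even)
  finally show ?thesis by (simp add: Reals_cnj_iff)
qed

lemma coeff_prod_linear_real:
  fixes S :: "complex set"
  assumes "S \<subseteq> \<real>"
  shows "coeff (\<Prod>a\<in>S. [:- a, 1:]) k \<in> \<real>"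
  using assms
proof (induction S arbitrary: k rule: infinite_finite_induct)
  case (insert b S)
  then have "coeff (\<Prod>a\<in>S. [:- a, 1:]) i \<in> \<real>" "b \<in> \<real>" for i
    by auto
  then show ?case
    using insert.hyps by (cases k) (auto simp: coeff_pCons)
qed (auto simp: coeff_1)

lemma poly_real_coeffs:
  fixes r :: "complex poly"
  assumes "\<And>k. coeff r k \<in> \<real>" and "z \<in> \<real>"
  shows "poly r z \<in> \<real>"
  unfolding poly_altdef using assms by auto

section \<open>Homomorphism numbers of glued graphs\<close>

definition hom_weight :: "multigraph \<Rightarrow> 'w weighted_graph \<Rightarrow> (nat \<Rightarrow> 'w) \<Rightarrow> complex" where
  "hom_weight G K f = (\<Prod>e \<in># edges G. K (map_uprod f e))"

lemma hom_number_hom_weight: "hom_number G K = (\<Sum>f \<in> verts G \<rightarrow>\<^sub>E UNIV. hom_weight G K f)"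
  unfolding hom_number_def hom_weight_def ..

text \<open>
  Since the edges of a well-formed graph lie within its vertex set, it does not matter how a map is
  extended beyond the vertices. This allows passing between maps on all of \<open>nat\<close> and their
  restrictions.
\<close>

lemma hom_weight_cong:
  assumes "wf_multigraph G" and "\<And>v. v \<in> verts G \<Longrightarrow> f v = g v"
  shows "hom_weight G K f = hom_weight G K g"
proof -
  have "map_uprod f e = map_uprod g e" if "e \<in># edges G" for e
    using assms that unfolding wf_multigraph_def by (intro uprod.map_cong) auto
  then show ?thesis
    unfolding hom_weight_def by (metis (no_types, lifting) image_mset_cong)
qed

lemma graph_parameter_hom_number: "graph_parameter (\<lambda>G. hom_number G K)"
  unfolding graph_parameter_def
proof (intro allI impI)
  fix G G'
  assume "wf_multigraph G \<and> wf_multigraph G' \<and> multigraph_iso G G'"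
  then obtain f where wf: "wf_multigraph G"
    and bij: "bij_betw f (verts G) (verts G')"
    and edges: "edges G' = image_mset (map_uprod f) (edges G)"
    unfolding multigraph_iso_def by blast
  show "hom_number G K = hom_number G' K"
    unfolding hom_number_hom_weight
  proof (rule sum.reindex_bij_witness[of _ "\<lambda>g. restrict (g \<circ> f) (verts G)"
        "\<lambda>g. restrict (g \<circ> inv_into (verts G) f) (verts G')"])
    have inv: "inv_into (verts G) f w \<in> verts G" "f (inv_into (verts G) f w) = w"
      if "w \<in> verts G'" for w
      using bij that by (auto simp: bij_betw_def inv_into_into f_inv_into_f)
    have inv': "f v \<in> verts G'" "inv_into (verts G) f (f v) = v" if "v \<in> verts G" for v
      using bij that by (auto simp: bij_betw_def inv_into_f_f)
    fix g :: "nat \<Rightarrow> 'a"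
    {
      assume g: "g \<in> verts G \<rightarrow>\<^sub>E UNIV"
      let ?g' = "restrict (g \<circ> inv_into (verts G) f) (verts G')"
      show "restrict (?g' \<circ> f) (verts G) = g"
        by (rule PiE_ext[OF _ g]) (use inv' in auto)
      show "?g' \<in> verts G' \<rightarrow>\<^sub>E UNIV" by auto
      have "hom_weight G' K ?g' = hom_weight G K (?g' \<circ> f)"
        by (simp add: hom_weight_def edges uprod.map_comp multiset.map_comp o_def)
      also have "\<dots> = hom_weight G K g"
        using wf inv' by (intro hom_weight_cong) auto
      finally show "hom_weight G' K ?g' = hom_weight G K g" .
    }
    {
      assume g: "g \<in> verts G' \<rightarrow>\<^sub>E UNIV"
      show "restrict (restrict (g \<circ> f) (verts G) \<circ> inv_into (verts G) f) (verts G') = g"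
        by (rule PiE_ext[OF _ g]) (use inv in auto)
      show "restrict (g \<circ> f) (verts G) \<in> verts G \<rightarrow>\<^sub>E UNIV" by auto
    }
  qed
qed

lemma glue_equivalent: "(glue X Y v, v) \<in> (same_label X Y \<union> (same_label X Y)\<inverse>)\<^sup>*"
  unfolding glue_def by (rule LeastI[of _ v]) simp

lemma glue_eq:
  assumes "(a, b) \<in> (same_label X Y \<union> (same_label X Y)\<inverse>)\<^sup>*"
  shows "glue X Y a = glue X Y b"
proof -
  let ?R = "(same_label X Y \<union> (same_label X Y)\<inverse>)\<^sup>*"
  have "sym ?R" by (intro sym_rtrancl) (rule sym_Un_converse)
  then have "(b, a) \<in> ?R" using assms by (rule symD)
  then have "(u, a) \<in> ?R \<longleftrightarrow> (u, b) \<in> ?R" for u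
    using assms by (meson rtrancl_trans)
  then show ?thesis unfolding glue_def by simp
qed

text \<open>
  Gluing is a pushout, so a map on the glued vertices is the same as a pair of maps on the two
  vertex sets that agree on the labels; the edges are those of both graphs, so weights multiply.
  The representatives chosen by \<open>glue\<close> enter only through two facts: each vertex is equivalent
  to its representative, and equivalent vertices have the same one. This also covers graphs in
  which one vertex carries both labels.
\<close>

lemma hom_number_lprod:
  fixes K :: "'w::finite weighted_graph"
  assumes X: "wf_lgraph X" and Y: "wf_lgraph Y"
  shows "hom_number (unlabel (lprod X Y)) K =
    (\<Sum>(f, g) \<in> {(f, g). f \<in> verts (unlabel X) \<rightarrow>\<^sub>E UNIV \<and> g \<in> verts (unlabel Y) \<rightarrow>\<^sub>E UNIV \<and>
                      f (lab1 X) = g (lab1 Y) \<and> f (lab2 X) = g (lab2 Y)}.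
       hom_weight (unlabel X) K f * hom_weight (unlabel Y) K g)"
  unfolding hom_number_hom_weight
proof -
  let ?VX = "verts (unlabel X)" and ?VY = "verts (unlabel Y)"
  let ?V = "verts (unlabel (lprod X Y))" and ?\<gamma> = "glue X Y"
  let ?R = "same_label X Y \<union> (same_label X Y)\<inverse>"
  let ?join = "\<lambda>f g v. case sum_decode v of Inl u \<Rightarrow> f u | Inr u \<Rightarrow> (g u :: 'w)"
  let ?left = "\<lambda>h. restrict (h \<circ> ?\<gamma> \<circ> inl) ?VX" and ?right = "\<lambda>h. restrict (h \<circ> ?\<gamma> \<circ> inr) ?VY"
  have V: "?V = (?\<gamma> \<circ> inl) ` ?VX \<union> (?\<gamma> \<circ> inr) ` ?VY"
    by (simp add: lprod_def)
  have lab: "lab1 X \<in> ?VX" "lab2 X \<in> ?VX" "lab1 Y \<in> ?VY" "lab2 Y \<in> ?VY"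
    and wf: "wf_multigraph (unlabel X)" "wf_multigraph (unlabel Y)"
    using X Y unfolding wf_lgraph_def by auto
  have glue_lab: "?\<gamma> (inl (lab1 X)) = ?\<gamma> (inr (lab1 Y))" "?\<gamma> (inl (lab2 X)) = ?\<gamma> (inr (lab2 Y))"
    by (rule glue_eq, force simp: same_label_def)+
  \<comment> \<open>A pair that agrees on the labels defines a map on the disjoint union that is constant on the
    classes of identified vertices, so it may be evaluated at representatives.\<close>
  have join_glue: "?join f g (?\<gamma> v) = ?join f g v"
    if "f (lab1 X) = g (lab1 Y)" "f (lab2 X) = g (lab2 Y)" for f g v
  proof -
    have "?join f g a = ?join f g b" if "(a, b) \<in> ?R\<^sup>*" for a b
      using that
    proof (induction rule: rtrancl_induct)
      case (step b c)
      from step.hyps(2) have "?join f g b = ?join f g c"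
        using \<open>f (lab1 X) = g (lab1 Y)\<close> \<open>f (lab2 X) = g (lab2 Y)\<close>
        by (auto simp: same_label_def)
      with step.IH show ?case by simp
    qed simp
    then show ?thesis
      using glue_equivalent by blast
  qed
  show "(\<Sum>h \<in> ?V \<rightarrow>\<^sub>E UNIV. hom_weight (unlabel (lprod X Y)) K h) =
    (\<Sum>(f, g) \<in> {(f, g). f \<in> ?VX \<rightarrow>\<^sub>E UNIV \<and> g \<in> ?VY \<rightarrow>\<^sub>E UNIV \<and>
                      f (lab1 X) = g (lab1 Y) \<and> f (lab2 X) = g (lab2 Y)}.
       hom_weight (unlabel X) K f * hom_weight (unlabel Y) K g)"
  proof (rule sum.reindex_bij_witness[of _ "\<lambda>(f, g). restrict (?join f g) ?V" "\<lambda>h. (?left h, ?right h)"])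
    fix h :: "nat \<Rightarrow> 'w"
    assume h: "h \<in> ?V \<rightarrow>\<^sub>E UNIV"
    have agree: "?left h (lab1 X) = ?right h (lab1 Y)" "?left h (lab2 X) = ?right h (lab2 Y)"
      using lab glue_lab by auto
    then show "(?left h, ?right h) \<in> {(f, g). f \<in> ?VX \<rightarrow>\<^sub>E UNIV \<and> g \<in> ?VY \<rightarrow>\<^sub>E UNIV \<and>
                      f (lab1 X) = g (lab1 Y) \<and> f (lab2 X) = g (lab2 Y)}"
      by auto
    have join: "?join (?left h) (?right h) v = h v" if "v \<in> ?V" for v
      using that unfolding V by (auto simp: join_glue[OF agree])
    show "(case (?left h, ?right h) of (f, g) \<Rightarrow> restrict (?join f g) ?V) = h"
      unfolding prod.case
      by (rule PiE_ext[OF _ h]) (simp_all only: join restrict_apply if_True restrict_PiE_iff UNIV_I ball_triv simp_thms)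
    have "hom_weight (unlabel (lprod X Y)) K h =
        hom_weight (unlabel X) K (h \<circ> ?\<gamma> \<circ> inl) * hom_weight (unlabel Y) K (h \<circ> ?\<gamma> \<circ> inr)"
      by (simp add: hom_weight_def lprod_def uprod.map_comp multiset.map_comp o_def)
    also have "\<dots> = hom_weight (unlabel X) K (?left h) * hom_weight (unlabel Y) K (?right h)"
      using hom_weight_cong[OF wf(1), of "h \<circ> ?\<gamma> \<circ> inl" "?left h"]
        hom_weight_cong[OF wf(2), of "h \<circ> ?\<gamma> \<circ> inr" "?right h"] by simp
    finally show "(case (?left h, ?right h) of
          (f, g) \<Rightarrow> hom_weight (unlabel X) K f * hom_weight (unlabel Y) K g) =
        hom_weight (unlabel (lprod X Y)) K h"
      by simp
  next
    fix fg
    assume "fg \<in> {(f, g). f \<in> ?VX \<rightarrow>\<^sub>E (UNIV :: 'w set) \<and> g \<in> ?VY \<rightarrow>\<^sub>E UNIV \<and>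
                      f (lab1 X) = g (lab1 Y) \<and> f (lab2 X) = g (lab2 Y)}"
    then obtain f g where fg: "fg = (f, g)" "f \<in> ?VX \<rightarrow>\<^sub>E UNIV" "g \<in> ?VY \<rightarrow>\<^sub>E UNIV"
      and agree: "f (lab1 X) = g (lab1 Y)" "f (lab2 X) = g (lab2 Y)"
      by blast
    have restr: "restrict (?join f g) ?V (?\<gamma> (inl v)) = f v" if "v \<in> ?VX" for v
      using that join_glue[OF agree, of "inl v"] unfolding V by auto
    have restr': "restrict (?join f g) ?V (?\<gamma> (inr v)) = g v" if "v \<in> ?VY" for v
      using that join_glue[OF agree, of "inr v"] unfolding V by auto
    have "?left (restrict (?join f g) ?V) = f"
      by (rule PiE_ext[OF _ fg(2)]) (simp_all only: restrict_PiE_iff UNIV_I ball_triv simp_thms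
        restrict_apply if_True o_apply restr[unfolded restrict_apply])
    moreover have "?right (restrict (?join f g) ?V) = g"
      by (rule PiE_ext[OF _ fg(3)]) (simp_all only: restrict_PiE_iff UNIV_I ball_triv simp_thms
        restrict_apply if_True o_apply restr'[unfolded restrict_apply])
    ultimately show "(?left (case fg of (f, g) \<Rightarrow> restrict (?join f g) ?V),
        ?right (case fg of (f, g) \<Rightarrow> restrict (?join f g) ?V)) = fg"
      unfolding fg(1) by simp
    show "(case fg of (f, g) \<Rightarrow> restrict (?join f g) ?V) \<in> ?V \<rightarrow>\<^sub>E UNIV"
      unfolding fg(1) by auto
  qed
qed

lemma wf_P1_pow: "wf_lgraph (P1_pow k)"
  by (auto simp: wf_lgraph_def wf_multigraph_def P1_pow_def)

lemma wf_K1: "wf_lgraph K1"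
  by (simp add: wf_lgraph_def wf_multigraph_def K1_def)

text \<open>
  When every vertex of \<open>Y\<close> is labelled, a map on \<open>Y\<close> is determined by the images of the labels, so
  the sum over pairs collapses to a sum over maps on \<open>X\<close>. If both labels of \<open>Y\<close> sit on one vertex,
  only those maps survive that send the two labelled vertices of \<open>X\<close> to the same place.
\<close>

lemma hom_number_lprod_spanned:
  fixes K :: "'w::finite weighted_graph"
  assumes X: "wf_lgraph X" and Y: "wf_lgraph Y"
    and spanned: "verts (unlabel Y) = {lab1 Y, lab2 Y}"
  shows "hom_number (unlabel (lprod X Y)) K =
    (\<Sum>f \<in> {f \<in> verts (unlabel X) \<rightarrow>\<^sub>E UNIV. lab1 Y = lab2 Y \<longrightarrow> f (lab1 X) = f (lab2 X)}.
       hom_weight (unlabel X) K f *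
       hom_weight (unlabel Y) K (\<lambda>v. if v = lab1 Y then f (lab1 X) else f (lab2 X)))"
proof -
  let ?VY = "verts (unlabel Y)" and ?F = "verts (unlabel X) \<rightarrow>\<^sub>E (UNIV :: 'w set)"
  let ?F' = "{f \<in> ?F. lab1 Y = lab2 Y \<longrightarrow> f (lab1 X) = f (lab2 X)}"
  let ?ext = "\<lambda>(f :: nat \<Rightarrow> 'w) v. if v = lab1 Y then f (lab1 X) else f (lab2 X)"
  let ?pair = "\<lambda>f. (f, restrict (?ext f) ?VY)"
  have lab: "lab1 Y \<in> ?VY" "lab2 Y \<in> ?VY"
    using Y unfolding wf_lgraph_def by auto
  have pairs: "{(f, g). f \<in> ?F \<and> g \<in> ?VY \<rightarrow>\<^sub>E UNIV \<and>
      f (lab1 X) = g (lab1 Y) \<and> f (lab2 X) = g (lab2 Y)} = ?pair ` ?F'" (is "?S = _")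
  proof (intro equalityI subsetI)
    fix a assume "a \<in> ?S"
    then obtain f g where a: "a = (f, g)" and f: "f \<in> ?F" and g: "g \<in> ?VY \<rightarrow>\<^sub>E UNIV"
      and agree: "f (lab1 X) = g (lab1 Y)" "f (lab2 X) = g (lab2 Y)"
      by blast
    have "g v = restrict (?ext f) ?VY v" if "v \<in> ?VY" for v
      using that agree spanned by auto
    then have "g = restrict (?ext f) ?VY"
      by (intro PiE_ext[OF g restrict_PiE_iff[THEN iffD2]]) simp_all
    moreover have "f \<in> ?F'" using f agree by auto
    ultimately show "a \<in> ?pair ` ?F'" unfolding a by blast
  next
    fix a assume "a \<in> ?pair ` ?F'"
    then obtain f where a: "a = ?pair f" and f: "f \<in> ?F'" by blast
    have "restrict (?ext f) ?VY \<in> ?VY \<rightarrow>\<^sub>E UNIV"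
      by (rule restrict_PiE_iff[THEN iffD2]) simp
    then show "a \<in> ?S" using f lab unfolding a by simp
  qed
  have inj: "inj_on ?pair ?F'"
    by (simp add: inj_on_def)
  have "hom_weight (unlabel Y) K (restrict (?ext f) ?VY) = hom_weight (unlabel Y) K (?ext f)" for f
    using Y by (intro hom_weight_cong) (simp_all add: wf_lgraph_def)
  then show ?thesis
    unfolding hom_number_lprod[OF X Y] pairs sum.reindex[OF inj] o_def prod.case by presburger
qed

lemma hom_number_lprod_P1_pow:
  fixes K :: "'w::finite weighted_graph"
  assumes X: "wf_lgraph X"
  shows "hom_number (unlabel (lprod X (P1_pow k))) K =
    (\<Sum>f \<in> verts (unlabel X) \<rightarrow>\<^sub>E UNIV.
       hom_weight (unlabel X) K f * K (Upair (f (lab1 X)) (f (lab2 X))) ^ k)"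
proof -
  have "hom_weight (unlabel (P1_pow k)) K (\<lambda>v. if v = lab1 (P1_pow k) then a else b) = K (Upair a b) ^ k"
    for a b
    by (simp add: hom_weight_def P1_pow_def)
  moreover have "lab1 (P1_pow k) \<noteq> lab2 (P1_pow k)"
    and "verts (unlabel (P1_pow k)) = {lab1 (P1_pow k), lab2 (P1_pow k)}"
    by (simp_all add: P1_pow_def)
  ultimately show ?thesis
    using hom_number_lprod_spanned[OF X wf_P1_pow, of k K] by simp
qed

lemma hom_number_lprod_K1:
  fixes K :: "'w::finite weighted_graph"
  assumes X: "wf_lgraph X"
  shows "hom_number (unlabel (lprod X K1)) K =
    (\<Sum>f \<in> verts (unlabel X) \<rightarrow>\<^sub>E UNIV.
       if f (lab1 X) = f (lab2 X) then hom_weight (unlabel X) K f else 0)"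
proof -
  have "finite (verts (unlabel X))"
    using X unfolding wf_lgraph_def wf_multigraph_def by blast
  then have fin: "finite (verts (unlabel X) \<rightarrow>\<^sub>E (UNIV :: 'w set))"
    by (intro finite_PiE) auto
  have "hom_weight (unlabel K1) K f = 1" for f
    by (simp add: hom_weight_def K1_def)
  moreover have "lab1 K1 = lab2 K1" and "verts (unlabel K1) = {lab1 K1, lab2 K1}"
    by (simp_all add: K1_def)
  ultimately have "hom_number (unlabel (lprod X K1)) K =
      (\<Sum>f \<in> {f \<in> verts (unlabel X) \<rightarrow>\<^sub>E UNIV. f (lab1 X) = f (lab2 X)}. hom_weight (unlabel X) K f)"
    using hom_number_lprod_spanned[OF X wf_K1, of K] by simp
  then show ?thesis
    unfolding sum.inter_filter[OF fin] .
qed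

section \<open>Linear extension to quantum graphs\<close>

text \<open>
  Evaluation of quantum graphs is extended to functions \<open>F\<close> that depend on the labels. The case
  needed is \<open>F Y = h (unlabel (lprod X Y))\<close>: the value of \<open>X\<close> multiplied by a quantum graph is then
  linear in the latter.
\<close>

definition qgraph_linear :: "(lgraph \<Rightarrow> complex) \<Rightarrow> qgraph \<Rightarrow> complex" where
  "qgraph_linear F Q = (\<Sum>X \<in> Poly_Mapping.keys Q. Poly_Mapping.lookup Q X * F X)"

lemma qgraph_eval_linear: "qgraph_eval h Q = qgraph_linear (\<lambda>X. h (unlabel X)) Q"
  unfolding qgraph_eval_def qgraph_linear_def ..

lemma qgraph_linear_superset:
  assumes "finite S" "Poly_Mapping.keys Q \<subseteq> S"
  shows "qgraph_linear F Q = (\<Sum>X \<in> S. Poly_Mapping.lookup Q X * F X)"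
  unfolding qgraph_linear_def
  using assms by (intro sum.mono_neutral_left) (auto simp: in_keys_iff)

lemma qgraph_linear_add: "qgraph_linear F (Q + R) = qgraph_linear F Q + qgraph_linear F R"
proof -
  let ?S = "Poly_Mapping.keys Q \<union> Poly_Mapping.keys R"
  have "qgraph_linear F P = (\<Sum>X \<in> ?S. Poly_Mapping.lookup P X * F X)"
    if "Poly_Mapping.keys P \<subseteq> ?S" for P
    using that by (intro qgraph_linear_superset) auto
  then show ?thesis
    using Poly_Mapping.keys_add[of Q R]
    by (simp add: lookup_add distrib_right sum.distrib)
qed

lemma qgraph_linear_sum: "qgraph_linear F (\<Sum>i\<in>I. Q i) = (\<Sum>i\<in>I. qgraph_linear F (Q i))"
  by (induction I rule: infinite_finite_induct) (simp_all add: qgraph_linear_add, simp_all add: qgraph_linear_def)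

lemma qgraph_linear_single: "qgraph_linear F (Poly_Mapping.single X c) = c * F X"
  by (simp add: qgraph_linear_superset[of "{X}"])

lemma qgraph_eval_prod_single:
  "qgraph_eval h (qgraph_prod (Poly_Mapping.single X 1) Q) =
   qgraph_linear (\<lambda>Y. h (unlabel (lprod X Y))) Q"
  by (simp add: qgraph_prod_def qgraph_eval_linear qgraph_linear_sum qgraph_linear_single)
    (simp add: qgraph_linear_def)

section \<open>The contractor\<close>

text \<open>
  The mechanism behind the contractor, for an arbitrary weighted graph: a polynomial that turns the
  weight of each pair \<open>u\<close>, \<open>v\<close> into the indicator of \<open>u = v\<close> restricts the sum over all maps to those
  that identify the two labelled vertices, and these are the maps counted after contraction.
\<close>

lemma contractor_of_interpolating_polynomial:
  fixes K :: "'w::finite weighted_graph"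
  assumes interp: "\<And>u v. (\<Sum>k<n. c k * K (Upair u v) ^ k) = (if u = v then 1 else 0)"
  shows "is_contractor (\<lambda>G. hom_number G K) (\<Sum>k<n. Poly_Mapping.single (P1_pow k) (c k))"
    (is "is_contractor _ ?Z")
  unfolding is_contractor_def
proof (intro conjI allI impI ballI)
  show "graph_parameter (\<lambda>G. hom_number G K)" by (rule graph_parameter_hom_number)
next
  fix Y
  assume "Y \<in> Poly_Mapping.keys ?Z"
  then have "Y \<in> (\<Union>k<n. Poly_Mapping.keys (Poly_Mapping.single (P1_pow k) (c k)))"
    by (rule subsetD[OF Poly_Mapping.keys_sum])
  then show "wf_lgraph Y"
    by (auto simp: wf_P1_pow split: if_splits)
next
  fix X
  assume "wf_lgraph X \<and> lab1 X \<noteq> lab2 X \<and> Upair (lab1 X) (lab2 X) \<notin># edges (unlabel X)"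
  then have X: "wf_lgraph X" by blast
  let ?V = "verts (unlabel X)" and ?w = "hom_weight (unlabel X) K"
  have "qgraph_eval (\<lambda>G. hom_number G K) (qgraph_prod (Poly_Mapping.single X 1) ?Z) =
      (\<Sum>k<n. \<Sum>f \<in> ?V \<rightarrow>\<^sub>E UNIV. ?w f * (c k * K (Upair (f (lab1 X)) (f (lab2 X))) ^ k))"
    unfolding qgraph_eval_prod_single qgraph_linear_sum qgraph_linear_single
      hom_number_lprod_P1_pow[OF X] sum_distrib_left by (simp only: mult.left_commute)
  also have "\<dots> = (\<Sum>f \<in> ?V \<rightarrow>\<^sub>E UNIV. \<Sum>k<n. ?w f * (c k * K (Upair (f (lab1 X)) (f (lab2 X))) ^ k))"
    by (rule sum.swap)
  also have "\<dots> = (\<Sum>f \<in> ?V \<rightarrow>\<^sub>E UNIV. if f (lab1 X) = f (lab2 X) then ?w f else 0)"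
    unfolding sum_distrib_left[symmetric] interp by (intro sum.cong) auto
  also have "\<dots> = hom_number (unlabel (lprod X K1)) K"
    by (rule hom_number_lprod_K1[OF X, symmetric])
  finally show "qgraph_eval (\<lambda>G. hom_number G K) (qgraph_prod (Poly_Mapping.single X 1) ?Z) =
      hom_number (unlabel (lprod X K1)) K" .
qed

theorem theorem13:
  fixes \<psi> \<beta> :: "'g::{finite, comm_ring} \<Rightarrow> complex"
    and e :: 'g
    and H Hhat :: "'g weighted_graph"
    and A :: "((complex, 'g) vec, 'g) vec"
    and s :: complex
    and p q :: "complex poly"
    and \<l> :: nat
    and Z :: qgraph
  assumes unity: "\<And>x. e * x = x"
    and generating: "generating_character \<psi>"
    and beta_even: "\<And>i. \<beta> (- i) = \<beta> i"
    and A: "A = circulant \<beta>"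
    and H: "adjacency_matrix H = A"
    and Hhat: "adjacency_matrix Hhat = circulant (fourier \<psi> \<beta>)"
    and connected: "weighted_connected H"
    and eigen: "A *v ones = s *s ones"
    and simple: "(\<forall>x. \<beta> x \<in> \<real>\<^sub>\<ge>\<^sub>0) \<or> (\<forall>v. A *v v = s *s v \<longrightarrow> (\<exists>c. v = c *s ones))"
    and p: "p = min_poly A"
    and l: "\<l> = degree p"
    and q: "q = p div [:- s, 1:]"
    and Z: "Z = (\<Sum>k<\<l>. Poly_Mapping.single (P1_pow k) (1 / poly q s * coeff q k))"
  shows "poly q s \<noteq> 0 \<and>
    is_contractor (\<lambda>G. hom_number G Hhat) Z \<and>
    ((\<forall>x. \<beta> x \<in> \<real>) \<longrightarrow> (\<forall>X. Poly_Mapping.lookup Z X \<in> \<real>))"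
proof -
  let ?S = "range (fourier \<psi> \<beta>)"
  have s: "s = fourier \<psi> \<beta> 0"
  proof -
    have "s = (\<Sum>j\<in>UNIV. \<beta> (- j))"
      using arg_cong[OF eigen, of "\<lambda>v. v $ 0"]
      by (simp add: A matrix_vector_mult_def circulant_def ones_def vector_scalar_mult_def)
    then show ?thesis
      by (simp add: beta_even fourier_zero[OF generating])
  qed
  have s_simple: "y = 0" if eq: "fourier \<psi> \<beta> y = s" for y
    using simple
  proof
    assume "\<forall>x. \<beta> x \<in> \<real>\<^sub>\<ge>\<^sub>0"
    then show ?thesis
      using fourier_eq_fourier_zero_nonneg[OF generating _ H[unfolded A] connected] eq s by blast
  next
    assume "\<forall>v. A *v v = s *s v \<longrightarrow> (\<exists>c. v = c *s ones)"
    then show ?thesis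
      using fourier_eq_fourier_zero_simple[OF generating] eq unfolding A s by blast
  qed
  have p_prod: "p = (\<Prod>a\<in>?S. [:- a, 1:])"
    unfolding p A by (rule min_poly_circulant[OF generating])
  have p_split: "p = [:- s, 1:] * (\<Prod>a\<in>?S - {s}. [:- a, 1:])"
    unfolding p_prod using s by (intro prod.remove) auto
  have q_prod: "q = (\<Prod>a\<in>?S - {s}. [:- a, 1:])"
    unfolding q by (subst p_split, rule nonzero_mult_div_cancel_left) simp
  have "q \<noteq> 0"
    unfolding q_prod by simp
  \<comment> \<open>The sum over \<open>k < \<l>\<close> reaches every coefficient of \<open>q\<close>.\<close>
  have deg: "degree q < \<l>"
    unfolding l p_split q_prod[symmetric] using \<open>q \<noteq> 0\<close>
    by (subst degree_mult_eq) auto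
  have qs: "poly q s \<noteq> 0"
    unfolding q_prod by (auto simp: poly_prod)
  have q_root: "poly q (fourier \<psi> \<beta> y) = 0" if "y \<noteq> 0" for y
    unfolding q_prod using that s_simple by (auto simp: poly_prod)
  have weight: "Hhat (Upair u v) = fourier \<psi> \<beta> (u - v)" for u v
    using arg_cong[OF Hhat, of "\<lambda>M. M $ u $ v"] by (simp add: adjacency_matrix_def circulant_def)
  have interp: "(\<Sum>k<\<l>. 1 / poly q s * coeff q k * Hhat (Upair u v) ^ k) = (if u = v then 1 else 0)" for u v
  proof -
    have "poly q x = (\<Sum>k<\<l>. coeff q k * x ^ k)" for x
      unfolding poly_altdef using deg
      by (intro sum.mono_neutral_left) (auto intro: coeff_eq_0)
    then have "(\<Sum>k<\<l>. 1 / poly q s * coeff q k * Hhat (Upair u v) ^ k) =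
        poly q (fourier \<psi> \<beta> (u - v)) / poly q s"
      by (simp add: weight sum_divide_distrib)
    then show ?thesis
      using qs q_root[of "u - v"] s by auto
  qed
  have "is_contractor (\<lambda>G. hom_number G Hhat) Z"
    unfolding Z by (rule contractor_of_interpolating_polynomial) (rule interp)
  moreover have "Poly_Mapping.lookup Z X \<in> \<real>" if real: "\<forall>x. \<beta> x \<in> \<real>" for X
  proof -
    have "fourier \<psi> \<beta> y \<in> \<real>" for y
      by (rule fourier_real[OF generating]) (use beta_even real in auto)
    then have "coeff q k \<in> \<real>" and "s \<in> \<real>" for k
      unfolding q_prod s by (auto intro!: coeff_prod_linear_real)
    then have "1 / poly q s * coeff q k \<in> \<real>" for k
      by (intro Reals_mult Reals_divide poly_real_coeffs) auto
    then show ?thesis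
      unfolding Z by (auto simp: lookup_sum lookup_single when_def intro!: sum_in_Reals)
  qed
  ultimately show ?thesis
    using qs by blast
qed

end
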